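(* Consider the energy-quadratized gradient flow system $\partial_t\Psi=\mathcal{N}(\Psi)\mathcal{B}\Psi$ described in the context, with constant $A$ and energy $\frac12\|\Psi\|_{\mathcal{B}}^2-A$. Let $s\ge1$ be an integer and let $b_i,a_{ij}$ ($i,j=1,\dots,s$) be real numbers satisfying $$b_i a_{ij}+b_j a_{ji}=b_i b_j,\qquad b_i\ge 0,\qquad \forall\, i,j=1,\dots,s.$$ Let $\Delta t>0$ be an arbitrary time step. Given $\Psi^n$, let $k_1,\dots,k_s$ and $\Psi^{n+1}$ be given by the $s$-stage HEQ-RK (Runge-Kutta) method $$k_i=\mathcal{N}\Big(\Psi^n+\Delta t\sum_{j=1}^s a_{ij}k_j\Big)\,\mathcal{B}\,\Big(\Psi^n+\Delta t\sum_{j=1}^s a_{ij}k_j\Big),\quad i=1,\dots,s,\qquad \Psi^{n+1}=\Psi^n+\Delta t\sum_{i=1}^s b_i k_i.$$ Then the method is unconditionally energy stable, i.e. (for every $\Delta t>0$) it satisfies the energy dissipation law $$F^{n+1}-F^n=\Delta t\sum_{i=1}^s b_i\big(\mathcal{B}\Psi_i,\ \mathcal{N}(\Psi_i)\mathcal{B}\Psi_i\big)\le 0,$$ where $F^{n}=\frac12\|\Psi^{n}\|_{\mathcal{B}}^2-A$, $F^{n+1}=\frac12\|\Psi^{n+1}\|_{\mathcal{B}}^2-A$, and $\Psi_i=\Psi^n+\Delta t\sum_{j=1}^s a_{ij}k_j$.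
   Context: Let $\Omega$ be the spatial domain, with periodic boundary conditions. For vector-valued functions on $\Omega$ with $\ell$ components, $(\mathbf{f},\mathbf{g})=\sum_{i=1}^{\ell}\int_\Omega f_i g_i\,d\mathbf{x}$ is the $L^2$ inner product and $\|\cdot\|$ the $L^2$ norm. Gradient flow: $\partial_t\Phi=\mathcal{G}\frac{\delta F}{\delta\Phi}$ for $\Phi=(\phi_1,\dots,\phi_m)^T$, where $\mathcal{G}$ is an $m\times m$ linear mobility matrix operator, possibly depending on $\Phi$, that is negative semi-definite, and $F=\frac12(\Phi,\mathcal{L}\Phi)+(f,1)$ with $\mathcal{L}$ a linear, self-adjoint, positive definite operator (independent of $\Phi$) and $f=f(\Phi)$ (or more generally $f=f(\Phi,\nabla\Phi)$) bounded from below. Energy quadratization (EQ) reformulation: with $A$ a constant large enough that $g=\sqrt{2(f+A/|\Omega|)}$ is well defined, introduce the auxiliary variable $q=g$ and $\Psi=(\Phi,q)^T$, which has $m+1$ components. The system becomes $\partial_t\Psi=\mathcal{N}(\Psi)\mathcal{B}\Psi$, where $\mathcal{B}=\mathrm{diag}(\mathcal{L},1)$ and $\mathcal{N}(\Psi)=\mathcal{A}^*\mathcal{G}\mathcal{A}$. Here $\mathcal{A}$ (depending on $\Psi$) is the operator mapping $(\Theta,r)^T$ to $\Theta+r\frac{\partial g}{\partial\Phi}$ when $g=g(\Phi)$, respectively to $\Theta+r\frac{\partial g}{\partial\Phi}-\nabla\cdot\big(r\frac{\partial g}{\partial\nabla\Phi}\big)$ when $g=g(\Phi,\nabla\Phi)$,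 and $\mathcal{A}^*$ is its $L^2$-adjoint, mapping $\Theta$ to $\big(\Theta,\frac{\partial g}{\partial\Phi}\cdot\Theta\big)^T$, respectively $\big(\Theta,\frac{\partial g}{\partial\Phi}\cdot\Theta+\frac{\partial g}{\partial\nabla\Phi}\cdot\nabla\Theta\big)^T$. Consequently, $\mathcal{B}$ is a linear, self-adjoint, positive definite operator independent of $\Psi$ and $t$, and for every $\Psi$ the linear operator $\mathcal{N}(\Psi)$ is negative semi-definite, i.e. $(v,\mathcal{N}(\Psi)v)\le0$ for all $v$ in its domain. The $\mathcal{B}$-norm is $\|\Psi\|_{\mathcal{B}}=\sqrt{(\Psi,\mathcal{B}\Psi)}$. In the time-discrete scheme, $\Psi^n$ denotes the approximation at the $n$-th time level, and $\Phi$ and $q$ are treated as independent unknowns (so $q=g$ is not required to hold at the discrete level). All functions (including $\Psi^n$ and the stages $k_i$) are real-valued, periodic and assumed to lie in a linear space of functions regular enough that $\mathcal{B}$ and $\mathcal{N}(\Psi)\mathcal{B}$ can be applied to them and all inner products are defined. *)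

theory Defs
  imports "HOL-Analysis.Analysis"
begin

text \<open>
  The spatial domain \<open>\<Omega>\<close> is the box \<open>cbox lo hi\<close> in \<open>real^'d\<close>, used as a period cell: a function on
  \<open>\<Omega>\<close> with periodic boundary conditions is a function on the whole space that is invariant under
  translation by each edge of the box.  A field with \<open>m + 1\<close> components \<open>\<Psi> = (\<Phi>, q)\<close> takes values in
  \<open>(real^'m) \<times> real\<close>.
\<close>

definition box_periodic :: "real^'d \<Rightarrow> real^'d \<Rightarrow> (real^'d \<Rightarrow> 'a) \<Rightarrow> bool" where
  "box_periodic lo hi u \<longleftrightarrow> (\<forall>x k. u (x + axis k (hi $ k - lo $ k)) = u x)"

definition L2_inner ::
  "real^'d \<Rightarrow> real^'d \<Rightarrow> (real^'d \<Rightarrow> 'a::euclidean_space) \<Rightarrow> (real^'d \<Rightarrow> 'a) \<Rightarrow> real" where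
  "L2_inner lo hi u v =
     (\<Sum>i\<in>Basis. integral\<^sup>L (lebesgue_on (cbox lo hi)) (\<lambda>x. (u x \<bullet> i) * (v x \<bullet> i)))"

definition L2_norm :: "real^'d \<Rightarrow> real^'d \<Rightarrow> (real^'d \<Rightarrow> 'a::euclidean_space) \<Rightarrow> real" where
  "L2_norm lo hi u = sqrt (L2_inner lo hi u u)"

definition periodic_L2 :: "real^'d \<Rightarrow> real^'d \<Rightarrow> (real^'d \<Rightarrow> 'a::euclidean_space) set" where
  "periodic_L2 lo hi = {u. box_periodic lo hi u \<and>
     u \<in> borel_measurable (lebesgue_on (cbox lo hi)) \<and>
     integrable (lebesgue_on (cbox lo hi)) (\<lambda>x. (norm (u x))\<^sup>2)}"

definition C1_field :: "(real^'d \<Rightarrow> 'a::euclidean_space) \<Rightarrow> bool" where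
  "C1_field u \<longleftrightarrow> (\<forall>x. u differentiable (at x)) \<and>
     (\<forall>h. continuous_on UNIV (\<lambda>x. frechet_derivative u (at x) h))"

definition linear_space :: "('x \<Rightarrow> 'a::real_vector) set \<Rightarrow> bool" where
  "linear_space V \<longleftrightarrow> (\<lambda>x. 0) \<in> V \<and>
     (\<forall>u\<in>V. \<forall>v\<in>V. \<forall>c d. (\<lambda>x. c *\<^sub>R u x + d *\<^sub>R v x) \<in> V)"

definition linear_operator ::
  "('x \<Rightarrow> 'a::real_vector) set \<Rightarrow> (('x \<Rightarrow> 'a) \<Rightarrow> ('x \<Rightarrow> 'b::real_vector)) \<Rightarrow> bool" where
  "linear_operator D T \<longleftrightarrow> linear_space D \<and>
     (\<forall>u\<in>D. \<forall>v\<in>D. \<forall>c d.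
        T (\<lambda>x. c *\<^sub>R u x + d *\<^sub>R v x) = (\<lambda>x. c *\<^sub>R T u x + d *\<^sub>R T v x))"

text \<open>
  The operators are in general unbounded, so each comes with a domain \<open>D\<close> of periodic
  square-integrable fields.  The condition \<open>L2_norm lo hi u \<noteq> 0\<close> expresses \<open>u \<noteq> 0\<close> up to null sets.
\<close>

definition L2_operator ::
  "real^'d \<Rightarrow> real^'d \<Rightarrow> (real^'d \<Rightarrow> 'a::euclidean_space) set \<Rightarrow>
   ((real^'d \<Rightarrow> 'a) \<Rightarrow> (real^'d \<Rightarrow> 'a)) \<Rightarrow> bool" where
  "L2_operator lo hi D T \<longleftrightarrow> linear_operator D T \<and>
     D \<subseteq> periodic_L2 lo hi \<and> T ` D \<subseteq> periodic_L2 lo hi"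

definition self_adjoint ::
  "real^'d \<Rightarrow> real^'d \<Rightarrow> (real^'d \<Rightarrow> 'a::euclidean_space) set \<Rightarrow>
   ((real^'d \<Rightarrow> 'a) \<Rightarrow> (real^'d \<Rightarrow> 'a)) \<Rightarrow> bool" where
  "self_adjoint lo hi D T \<longleftrightarrow> (\<forall>u\<in>D. \<forall>v\<in>D. L2_inner lo hi u (T v) = L2_inner lo hi (T u) v)"

definition positive_definite ::
  "real^'d \<Rightarrow> real^'d \<Rightarrow> (real^'d \<Rightarrow> 'a::euclidean_space) set \<Rightarrow>
   ((real^'d \<Rightarrow> 'a) \<Rightarrow> (real^'d \<Rightarrow> 'a)) \<Rightarrow> bool" where
  "positive_definite lo hi D T \<longleftrightarrow>
     (\<forall>u\<in>D. L2_norm lo hi u \<noteq> 0 \<longrightarrow> L2_inner lo hi u (T u) > 0)"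

definition negative_semidefinite ::
  "real^'d \<Rightarrow> real^'d \<Rightarrow> (real^'d \<Rightarrow> 'a::euclidean_space) set \<Rightarrow>
   ((real^'d \<Rightarrow> 'a) \<Rightarrow> (real^'d \<Rightarrow> 'a)) \<Rightarrow> bool" where
  "negative_semidefinite lo hi D T \<longleftrightarrow> (\<forall>u\<in>D. L2_inner lo hi u (T u) \<le> 0)"

definition gradient :: "('a::euclidean_space \<Rightarrow> real) \<Rightarrow> 'a \<Rightarrow> 'a" where
  "gradient h x = (\<Sum>i\<in>Basis. frechet_derivative h (at x) i *\<^sub>R i)"

text \<open>Row-wise divergence: component \<open>i\<close> is \<open>\<Sum>k. \<partial>P\<^sub>i\<^sub>k / \<partial>x\<^sub>k\<close>.\<close>

definition divergence :: "(real^'d \<Rightarrow> real^'d^'m) \<Rightarrow> real^'d \<Rightarrow> real^'m" where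
  "divergence P x = (\<chi> i. \<Sum>k\<in>UNIV. frechet_derivative (\<lambda>y. P y $ i $ k) (at x) (axis k 1))"

text \<open>
  The density is a function \<open>f u p\<close> of the value \<open>u = \<Phi>(x)\<close> and the gradient
  \<open>p = \<nabla>\<Phi>(x)\<close> (a matrix, \<open>p $ i $ k = \<partial>\<phi>\<^sub>i / \<partial>x\<^sub>k\<close>).  For a density depending on \<open>\<Phi>\<close> only, \<open>f u p\<close> is
  constant in \<open>p\<close>; then \<open>\<partial>g / \<partial>\<nabla>\<Phi>\<close> is identically zero and the operators below lose their
  gradient terms.
\<close>

definition gradient_dependent :: "(real^'m \<Rightarrow> real^'d^'m \<Rightarrow> real) \<Rightarrow> bool" where
  "gradient_dependent f \<longleftrightarrow> (\<exists>u p p'. f u p \<noteq> f u p')"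

definition eq_g ::
  "real^'d \<Rightarrow> real^'d \<Rightarrow> real \<Rightarrow> (real^'m \<Rightarrow> real^'d^'m \<Rightarrow> real) \<Rightarrow> real^'m \<Rightarrow> real^'d^'m \<Rightarrow> real" where
  "eq_g lo hi A f u p = sqrt (2 * (f u p + A / measure lebesgue (cbox lo hi)))"

definition dg_dPhi ::
  "(real^'m \<Rightarrow> real^'d^'m \<Rightarrow> real) \<Rightarrow> (real^'d \<Rightarrow> real^'m) \<Rightarrow> real^'d \<Rightarrow> real^'m" where
  "dg_dPhi g \<Phi> x = gradient (\<lambda>u. g u (jacobian \<Phi> (at x))) (\<Phi> x)"

definition dg_dGradPhi ::
  "(real^'m \<Rightarrow> real^'d^'m \<Rightarrow> real) \<Rightarrow> (real^'d \<Rightarrow> real^'m) \<Rightarrow> real^'d \<Rightarrow> real^'d^'m" where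
  "dg_dGradPhi g \<Phi> x = gradient (\<lambda>p. g (\<Phi> x) p) (jacobian \<Phi> (at x))"

definition eq_A ::
  "(real^'m \<Rightarrow> real^'d^'m \<Rightarrow> real) \<Rightarrow> (real^'d \<Rightarrow> real^'m) \<Rightarrow>
   (real^'d \<Rightarrow> (real^'m) \<times> real) \<Rightarrow> real^'d \<Rightarrow> real^'m" where
  "eq_A g \<Phi> v x = fst (v x) + snd (v x) *\<^sub>R dg_dPhi g \<Phi> x
     - divergence (\<lambda>y. snd (v y) *\<^sub>R dg_dGradPhi g \<Phi> y) x"

definition eq_A_adj ::
  "(real^'m \<Rightarrow> real^'d^'m \<Rightarrow> real) \<Rightarrow> (real^'d \<Rightarrow> real^'m) \<Rightarrow>
   (real^'d \<Rightarrow> real^'m) \<Rightarrow> real^'d \<Rightarrow> (real^'m) \<times> real" where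
  "eq_A_adj g \<Phi> \<Theta> x =
     (\<Theta> x, dg_dPhi g \<Phi> x \<bullet> \<Theta> x + dg_dGradPhi g \<Phi> x \<bullet> jacobian \<Theta> (at x))"

definition eq_N ::
  "(real^'m \<Rightarrow> real^'d^'m \<Rightarrow> real) \<Rightarrow>
   ((real^'d \<Rightarrow> real^'m) \<Rightarrow> (real^'d \<Rightarrow> real^'m) \<Rightarrow> (real^'d \<Rightarrow> real^'m)) \<Rightarrow>
   (real^'d \<Rightarrow> (real^'m) \<times> real) \<Rightarrow> (real^'d \<Rightarrow> (real^'m) \<times> real) \<Rightarrow> (real^'d \<Rightarrow> (real^'m) \<times> real)" where
  "eq_N g G \<Psi> v = eq_A_adj g (fst \<circ> \<Psi>) (G (fst \<circ> \<Psi>) (eq_A g (fst \<circ> \<Psi>) v))"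

definition eq_B ::
  "((real^'d \<Rightarrow> real^'m) \<Rightarrow> (real^'d \<Rightarrow> real^'m)) \<Rightarrow>
   (real^'d \<Rightarrow> (real^'m) \<times> real) \<Rightarrow> (real^'d \<Rightarrow> (real^'m) \<times> real)" where
  "eq_B L \<Psi> x = (L (fst \<circ> \<Psi>) x, snd (\<Psi> x))"

text \<open>
  The fields \<open>v\<close> to which \<open>eq_N g G \<Psi>\<close> can be applied, where \<open>DG \<Phi>\<close> is the domain of \<open>G \<Phi>\<close>.  When \<open>g\<close>
  depends on \<open>\<nabla>\<Phi>\<close>, the derivatives in \<open>\<nabla>\<Phi>\<close>, \<open>eq_A\<close> and \<open>eq_A_adj\<close> are understood classically.
\<close>

definition eq_N_domain ::
  "real^'d \<Rightarrow> real^'d \<Rightarrow> (real^'m \<Rightarrow> real^'d^'m \<Rightarrow> real) \<Rightarrow>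
   ((real^'d \<Rightarrow> real^'m) \<Rightarrow> (real^'d \<Rightarrow> real^'m) \<Rightarrow> (real^'d \<Rightarrow> real^'m)) \<Rightarrow>
   ((real^'d \<Rightarrow> real^'m) \<Rightarrow> (real^'d \<Rightarrow> real^'m) set) \<Rightarrow>
   (real^'d \<Rightarrow> (real^'m) \<times> real) \<Rightarrow> (real^'d \<Rightarrow> (real^'m) \<times> real) set" where
  "eq_N_domain lo hi g G DG \<Psi> = {v. v \<in> periodic_L2 lo hi \<and>
     eq_A g (fst \<circ> \<Psi>) v \<in> DG (fst \<circ> \<Psi>) \<and>
     (gradient_dependent g \<longrightarrow>
        (\<forall>x. (fst \<circ> \<Psi>) differentiable (at x)) \<and>
        C1_field (\<lambda>x. snd (v x) *\<^sub>R dg_dGradPhi g (fst \<circ> \<Psi>) x) \<and>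
        C1_field (G (fst \<circ> \<Psi>) (eq_A g (fst \<circ> \<Psi>) v)))}"

definition B_norm ::
  "real^'d \<Rightarrow> real^'d \<Rightarrow> ((real^'d \<Rightarrow> real^'m) \<Rightarrow> (real^'d \<Rightarrow> real^'m)) \<Rightarrow>
   (real^'d \<Rightarrow> (real^'m) \<times> real) \<Rightarrow> real" where
  "B_norm lo hi L \<Psi> = sqrt (L2_inner lo hi \<Psi> (eq_B L \<Psi>))"

definition eq_energy ::
  "real^'d \<Rightarrow> real^'d \<Rightarrow> ((real^'d \<Rightarrow> real^'m) \<Rightarrow> (real^'d \<Rightarrow> real^'m)) \<Rightarrow> real \<Rightarrow>
   (real^'d \<Rightarrow> (real^'m) \<times> real) \<Rightarrow> real" where
  "eq_energy lo hi L A \<Psi> = (B_norm lo hi L \<Psi>)\<^sup>2 / 2 - A"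

end

theory Submission
  imports Defs
begin

text \<open>
  Two independent facts make the scheme dissipative.

  The first is algebraic.  Up to the constant \<open>A\<close>, the energy is half of the quadratic form
  \<open>E(\<Psi>, \<Psi>)\<close> with \<open>E(u, v) = (u, \<B>v)\<close>, a symmetric form because \<open>L\<close> is self-adjoint.  For
  coefficients with \<open>b\<^sub>i a\<^sub>i\<^sub>j + b\<^sub>j a\<^sub>j\<^sub>i = b\<^sub>i b\<^sub>j\<close> a Runge-Kutta step changes any symmetric quadratic form by
  exactly \<open>2 dt \<Sum>\<^sub>i b\<^sub>i E(\<Psi>\<^sub>i, k\<^sub>i)\<close>, whatever the increments \<open>k\<^sub>i\<close> are: the terms of order \<open>dt\<^sup>2\<close>
  cancel (\<open>symplectic_RK_quadratic_identity\<close>).  Inserting \<open>k\<^sub>i = \<N>(\<Psi>\<^sub>i)\<B>\<Psi>\<^sub>i\<close> gives the energy law.  Since the energy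
  is defined as a squared square root, the form must also be nonnegative on the diagonal
  (\<open>L2_inner_nonneg_of_positive_definite\<close>).

  The second is analytic: each summand \<open>(\<B>\<Psi>\<^sub>i, \<N>(\<Psi>\<^sub>i)\<B>\<Psi>\<^sub>i)\<close> is nonpositive, because
  \<open>\<N> = \<A>\<^sup>* \<G> \<A>\<close> with \<open>\<G>\<close> negative semi-definite.  That \<open>\<A>\<^sup>*\<close> really is adjoint to \<open>\<A>\<close> on the
  relevant fields (\<open>eq_A_adjoint\<close>) is an integration by parts on the period cell; its boundary terms
  cancel because a partial derivative of a periodic \<open>C\<^sup>1\<close> function has integral zero over the cell
  (\<open>integral_periodic_partial_derivative\<close>).
\<close>

section \<open>Integrals of periodic functions over a period cell\<close>

text \<open>
  Cut the box swept out by \<open>cbox lo hi\<close> and its translate along axis \<open>j\<close> in two ways, at the far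
  face of the original and at the near face of the translate.  Each cut splits off one of the two
  boxes, and the two leftover slabs are congruent by a shift of one full period.
\<close>

lemma integral_periodic_translate:
  fixes F :: "real^'d \<Rightarrow> real"
  assumes cont: "continuous_on UNIV F"
    and per: "\<And>x. F (x + axis j (hi $ j - lo $ j)) = F x"
    and t: "0 \<le> t" "t \<le> hi $ j - lo $ j"
  shows "integral (cbox lo hi) (\<lambda>x. F (x + axis j t)) = integral (cbox lo hi) F"
proof -
  define c p where "c = axis j t" and "p = axis j (hi $ j - lo $ j)"
  have int: "F integrable_on cbox a b" for a b
    using cont by (intro integrable_continuous) (rule continuous_on_subset, auto)
  have B: "axis j 1 \<in> (Basis :: (real^'d) set)" by simp
  have split: "integral (cbox lo (hi + c)) F =
      integral (cbox lo (hi + c) \<inter> {x. x $ j \<le> r}) F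
      + integral (cbox lo (hi + c) \<inter> {x. x $ j \<ge> r}) F" for r
    using integral_split[OF int B, of lo "hi + c" r] by (simp add: inner_axis)
  \<comment> \<open>Only coordinate \<open>j\<close> distinguishes the boxes below, so it is separated from the others.\<close>
  have mem: "x \<in> cbox l u \<longleftrightarrow> (l $ j \<le> x $ j \<and> x $ j \<le> u $ j)
      \<and> (\<forall>i. i \<noteq> j \<longrightarrow> l $ i \<le> x $ i \<and> x $ i \<le> u $ i)" for x l u :: "real^'d"
    unfolding mem_box_cart by metis
  have cuts: "cbox lo (hi + c) \<inter> {x. x $ j \<le> hi $ j} = cbox lo hi"
    "cbox lo (hi + c) \<inter> {x. x $ j \<ge> hi $ j} = cbox (lo + p) (hi + c)"
    "cbox lo (hi + c) \<inter> {x. x $ j \<le> lo $ j + t} = cbox lo (hi + c - p)"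
    "cbox lo (hi + c) \<inter> {x. x $ j \<ge> lo $ j + t} = cbox (lo + c) (hi + c)"
    using t unfolding set_eq_iff Int_iff mem_Collect_eq mem c_def p_def
    by (auto simp: axis_def)
  have "integral (cbox lo (hi + c - p)) F = integral (cbox lo (hi + c - p)) (F \<circ> (+) p)"
    using per by (simp add: o_def add.commute p_def)
  also have "\<dots> = integral (cbox (lo + p) (hi + c)) F"
    by (simp add: integral_shift_cbox_plus)
  finally have "integral (cbox (lo + c) (hi + c)) F = integral (cbox lo hi) F"
    using split[of "hi $ j"] split[of "lo $ j + t"] unfolding cuts by simp
  then show ?thesis
    unfolding integral_shift_cbox_plus[symmetric] by (simp add: o_def add.commute c_def)
qed

text \<open>
  The integral over the cell of \<open>x \<mapsto> h (x + t e\<^sub>j)\<close> is constant in \<open>t\<close> by periodicity, while its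
  derivative in \<open>t\<close> at \<open>0\<close>, taken under the integral sign, is the integral of the partial
  derivative.  This avoids slicing the cell into lines with Fubini's theorem.
\<close>

lemma integral_periodic_partial_derivative:
  fixes h :: "real^'d \<Rightarrow> real"
  assumes pos: "lo $ j < hi $ j"
    and per: "\<And>x. h (x + axis j (hi $ j - lo $ j)) = h x"
    and deriv: "\<And>x. (h has_derivative h' x) (at x)"
    and cont: "continuous_on UNIV (\<lambda>x. h' x (axis j 1))"
  shows "integral (cbox lo hi) (\<lambda>x. h' x (axis j 1)) = 0"
proof -
  define T where "T = hi $ j - lo $ j"
  have T: "0 < T" using pos by (simp add: T_def)
  define e :: "real^'d" where "e = axis j 1"
  have axis: "axis j t = t *\<^sub>R e" for t :: real
    by (simp add: e_def axis_def vec_eq_iff)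
  have hc: "continuous_on UNIV h"
    using deriv has_derivative_continuous by (metis continuous_at_imp_continuous_on)
  have sub: "continuous_on S (\<lambda>z. k (f z))" if "continuous_on UNIV k" "continuous_on S f"
    for S :: "'z::topological_space set" and k :: "real^'d \<Rightarrow> real" and f
    using continuous_on_compose2[OF that(1,2)] by simp
  have line: "((\<lambda>t. h (x + t *\<^sub>R e)) has_vector_derivative h' (x + t *\<^sub>R e) e)
      (at t within {0..T})" for x t
  proof -
    have "((\<lambda>t. x + t *\<^sub>R e) has_derivative (\<lambda>s. s *\<^sub>R e)) (at t within {0..T})"
      by (auto intro!: derivative_eq_intros)
    from has_derivative_compose[OF this deriv]
    have "((\<lambda>t. h (x + t *\<^sub>R e)) has_derivative
        (\<lambda>s. h' (x + t *\<^sub>R e) (s *\<^sub>R e))) (at t within {0..T})" .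
    moreover have "h' y (s *\<^sub>R e) = s *\<^sub>R h' y e" for y s
      using deriv[of y] by (intro linear_cmul has_derivative_linear)
    ultimately show ?thesis
      by (simp add: has_vector_derivative_def)
  qed
  define \<phi> where "\<phi> t = integral (cbox lo hi) (\<lambda>x. h (x + t *\<^sub>R e))" for t
  have "(\<phi> has_vector_derivative integral (cbox lo hi) (\<lambda>x. h' (x + 0 *\<^sub>R e) e)) (at 0 within {0..T})"
    unfolding \<phi>_def
  proof (rule leibniz_rule_vector_derivative[OF line])
    show "(\<lambda>x. h (x + t *\<^sub>R e)) integrable_on cbox lo hi" for t
      by (intro integrable_continuous sub[OF hc] continuous_intros)
    show "continuous_on ({0..T} \<times> cbox lo hi) (\<lambda>(t, x). h' (x + t *\<^sub>R e) e)"
      unfolding split_beta e_def by (intro sub[OF cont] continuous_intros)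
  qed (use T in auto)
  moreover have "(\<phi> has_vector_derivative 0) (at 0 within {0..T})"
  proof (rule has_vector_derivative_transform[OF _ _ has_vector_derivative_const])
    show "\<phi> t = integral (cbox lo hi) h" if "t \<in> {0..T}" for t
      using integral_periodic_translate[OF hc per, of t] that by (simp add: \<phi>_def T_def axis)
  qed (use T in auto)
  ultimately have "integral (cbox lo hi) (\<lambda>x. h' (x + 0 *\<^sub>R e) e) = 0"
    using vector_derivative_unique_within_closed_interval[of 0 T 0] T by simp
  then show ?thesis by (simp add: e_def)
qed

section \<open>Square-integrable fields\<close>

text \<open>
  The part of \<open>periodic_L2\<close> that concerns integrals, so that the two components of a pair, and
  combinations of fields, can be estimated as square-integrable functions of their own.
\<close>

definition sq_integrable :: "'x measure \<Rightarrow> ('x \<Rightarrow> 'a::euclidean_space) \<Rightarrow> bool" where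
  "sq_integrable M u \<longleftrightarrow> u \<in> borel_measurable M \<and> integrable M (\<lambda>x. (norm (u x))\<^sup>2)"

text \<open>
  Both the componentwise products in the \<open>L\<^sup>2\<close> inner product and the pointwise inner product are
  of this form.
\<close>

lemma integrable_mult_of_squares:
  fixes p :: "'x \<Rightarrow> real"
  assumes u: "sq_integrable M u" and v: "sq_integrable M v"
    and [measurable]: "p \<in> borel_measurable M"
    and bound: "\<And>x. \<bar>p x\<bar> \<le> norm (u x) * norm (v x)"
  shows "integrable M p"
proof (rule Bochner_Integration.integrable_bound)
  show "integrable M (\<lambda>x. (norm (u x))\<^sup>2 + (norm (v x))\<^sup>2)"
    using u v by (auto simp: sq_integrable_def)
  have "\<bar>p x\<bar> \<le> (norm (u x))\<^sup>2 + (norm (v x))\<^sup>2" for x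
    using bound[of x] sum_squares_bound[of "norm (u x)" "norm (v x)"]
      mult_nonneg_nonneg[OF norm_ge_zero[of "u x"] norm_ge_zero[of "v x"]] by linarith
  then show "AE x in M. norm (p x) \<le> norm ((norm (u x))\<^sup>2 + (norm (v x))\<^sup>2)"
    by auto
qed simp

lemma integrable_inner:
  fixes u v :: "'x \<Rightarrow> 'a::euclidean_space"
  assumes "sq_integrable M u" "sq_integrable M v"
  shows "integrable M (\<lambda>x. u x \<bullet> v x)"
  using assms by (intro integrable_mult_of_squares[OF assms] Cauchy_Schwarz_ineq2)
    (auto simp: sq_integrable_def)

lemma L2_inner_commute: "L2_inner lo hi u v = L2_inner lo hi v u"
  by (simp add: L2_inner_def mult.commute)

lemma L2_inner_eq_integral:
  fixes u v :: "real^'d \<Rightarrow> 'a::euclidean_space"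
  assumes "sq_integrable (lebesgue_on (cbox lo hi)) u" "sq_integrable (lebesgue_on (cbox lo hi)) v"
  shows "L2_inner lo hi u v = integral\<^sup>L (lebesgue_on (cbox lo hi)) (\<lambda>x. u x \<bullet> v x)"
proof -
  have "integrable (lebesgue_on (cbox lo hi)) (\<lambda>x. (u x \<bullet> i) * (v x \<bullet> i))" if "i \<in> Basis" for i
    using assms that
    by (intro integrable_mult_of_squares[OF assms])
      (auto simp: sq_integrable_def abs_mult intro!: mult_mono Basis_le_norm)
  then show ?thesis
    by (simp add: L2_inner_def euclidean_inner[of "u _" "v _"] Bochner_Integration.integral_sum)
qed

lemma periodic_L2_sq_integrable:
  "u \<in> periodic_L2 lo hi \<Longrightarrow> sq_integrable (lebesgue_on (cbox lo hi)) u"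
  by (simp add: periodic_L2_def sq_integrable_def)

lemma sq_integrable_fst_snd:
  fixes u :: "'x \<Rightarrow> 'a::euclidean_space \<times> real"
  assumes "sq_integrable M u"
  shows "sq_integrable M (\<lambda>x. fst (u x))" "sq_integrable M (\<lambda>x. snd (u x))"
proof -
  have [measurable]: "u \<in> borel_measurable M" and *: "integrable M (\<lambda>x. (norm (u x))\<^sup>2)"
    using assms by (auto simp: sq_integrable_def)
  have f: "(\<lambda>x. fst (u x)) \<in> borel_measurable M"
    by (rule borel_measurable_continuous_on[OF continuous_on_fst[OF continuous_on_id]]) simp
  have s: "(\<lambda>x. snd (u x)) \<in> borel_measurable M"
    by (rule borel_measurable_continuous_on[OF continuous_on_snd[OF continuous_on_id]]) simp
  note fs[measurable] = f s
  have "(norm (fst z))\<^sup>2 \<le> (norm z)\<^sup>2" "(norm (snd z))\<^sup>2 \<le> (norm z)\<^sup>2" for z :: "'a \<times> real"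
    by (cases z; simp add: norm_Pair)+
  then have "integrable M (\<lambda>x. (norm (fst (u x)))\<^sup>2)" "integrable M (\<lambda>x. (norm (snd (u x)))\<^sup>2)"
    by (intro Bochner_Integration.integrable_bound[OF *]; simp)+
  then show "sq_integrable M (\<lambda>x. fst (u x))" "sq_integrable M (\<lambda>x. snd (u x))"
    unfolding sq_integrable_def using fs by auto
qed

text \<open>
  Strict positivity is only available for fields of nonzero norm.  A field of norm zero vanishes
  almost everywhere, so it pairs to zero with any field whatsoever.  The bound makes the square root
  in the energy norm genuine.
\<close>

lemma L2_inner_nonneg_of_positive_definite:
  assumes pd: "positive_definite lo hi D T" and u: "u \<in> D"
    and L2: "u \<in> periodic_L2 lo hi"
  shows "0 \<le> L2_inner lo hi u (T u)"
proof (cases "L2_norm lo hi u = 0")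
  case False
  then show ?thesis using pd u by (force simp: positive_definite_def)
next
  case True
  let ?M = "lebesgue_on (cbox lo hi)"
  have sq: "sq_integrable ?M u" using L2 by (rule periodic_L2_sq_integrable)
  have "integral\<^sup>L ?M (\<lambda>x. u x \<bullet> u x) = 0"
    using True by (simp add: L2_norm_def L2_inner_eq_integral[OF sq sq])
  then have "AE x in ?M. u x \<bullet> u x = 0"
    using integral_nonneg_eq_0_iff_AE[OF integrable_inner[OF sq sq]] by simp
  then have ae: "AE x in ?M. u x = 0" by simp
  have "integral\<^sup>L ?M (\<lambda>x. (u x \<bullet> i) * (T u x \<bullet> i)) = 0" for i
    using ae by (intro integral_eq_zero_AE) (auto elim: eventually_mono)
  then show ?thesis by (simp add: L2_inner_def)
qed

text \<open>
  Splitting into the \<open>\<Phi>\<close> and \<open>q\<close> parts reduces symmetry and positivity of \<open>eq_B L\<close> to the same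
  properties of \<open>L\<close>.
\<close>

lemma L2_inner_eq_B:
  assumes u: "sq_integrable (lebesgue_on (cbox lo hi)) u"
    and Bv: "sq_integrable (lebesgue_on (cbox lo hi)) (eq_B L v)"
  shows "L2_inner lo hi u (eq_B L v) = L2_inner lo hi (fst \<circ> u) (L (fst \<circ> v))
     + integral\<^sup>L (lebesgue_on (cbox lo hi)) (\<lambda>x. snd (u x) * snd (v x))"
proof -
  note fu = sq_integrable_fst_snd[OF u]
    and fv = sq_integrable_fst_snd[OF Bv, unfolded eq_B_def fst_conv snd_conv]
  have "L2_inner lo hi u (eq_B L v) = integral\<^sup>L (lebesgue_on (cbox lo hi))
      (\<lambda>x. fst (u x) \<bullet> L (fst \<circ> v) x + snd (u x) \<bullet> snd (v x))"
    by (simp add: L2_inner_eq_integral[OF u Bv] eq_B_def inner_prod_def)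
  also have "\<dots> = integral\<^sup>L (lebesgue_on (cbox lo hi)) (\<lambda>x. fst (u x) \<bullet> L (fst \<circ> v) x)
      + integral\<^sup>L (lebesgue_on (cbox lo hi)) (\<lambda>x. snd (u x) \<bullet> snd (v x))"
    by (intro Bochner_Integration.integral_add integrable_inner fu fv)
  finally show ?thesis
    using L2_inner_eq_integral[OF fu(1) fv(1)] by (simp add: o_def)
qed

lemma L2_inner_linear_left:
  assumes u: "sq_integrable (lebesgue_on (cbox lo hi)) u"
    and v: "sq_integrable (lebesgue_on (cbox lo hi)) v"
    and w: "sq_integrable (lebesgue_on (cbox lo hi)) w"
    and uv: "sq_integrable (lebesgue_on (cbox lo hi)) (\<lambda>x. c *\<^sub>R u x + d *\<^sub>R v x)"
  shows "L2_inner lo hi (\<lambda>x. c *\<^sub>R u x + d *\<^sub>R v x) w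
    = c * L2_inner lo hi u w + d * L2_inner lo hi v w"
  using integrable_inner[OF u w] integrable_inner[OF v w]
  by (simp add: L2_inner_eq_integral[OF uv w] L2_inner_eq_integral[OF u w]
      L2_inner_eq_integral[OF v w] inner_add_left)

section \<open>Symplectic Runge-Kutta methods and quadratic forms\<close>

lemma linear_space_add_sum:
  assumes V: "linear_space V" and u: "u \<in> V" and "finite I" and k: "\<And>i. i \<in> I \<Longrightarrow> k i \<in> V"
  shows "(\<lambda>x. u x + r *\<^sub>R (\<Sum>i\<in>I. c i *\<^sub>R k i x)) \<in> V"
  using \<open>finite I\<close> k
proof (induction I)
  case empty
  then show ?case using u by simp
next
  case (insert i I)
  then have "(\<lambda>x. 1 *\<^sub>R (u x + r *\<^sub>R (\<Sum>i\<in>I. c i *\<^sub>R k i x)) + (r * c i) *\<^sub>R k i x) \<in> V"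
    using V[unfolded linear_space_def, THEN conjunct2, rule_format, of _ "k i" 1 "r * c i"] by simp
  then show ?case using insert by (simp add: algebra_simps)
qed

text \<open>
  Functions into a vector space are added here pointwise, under a lambda, rather than as elements of a
  vector space; this evaluates \<open>E\<close> on Runge-Kutta stages written in that way.
\<close>

lemma form_add_sum:
  fixes E :: "('x \<Rightarrow> 'a::real_vector) \<Rightarrow> ('x \<Rightarrow> 'a) \<Rightarrow> real"
  assumes V: "linear_space V"
    and lin: "\<And>u v w c d. \<lbrakk>u \<in> V; v \<in> V; w \<in> V\<rbrakk> \<Longrightarrow>
      E (\<lambda>x. c *\<^sub>R u x + d *\<^sub>R v x) w = c * E u w + d * E v w"
    and u: "u \<in> V" and w: "w \<in> V" and "finite I" and k: "\<And>i. i \<in> I \<Longrightarrow> k i \<in> V"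
  shows "E (\<lambda>x. u x + r *\<^sub>R (\<Sum>i\<in>I. c i *\<^sub>R k i x)) w = E u w + r * (\<Sum>i\<in>I. c i * E (k i) w)"
  using \<open>finite I\<close> k
proof (induction I)
  case empty
  then show ?case by simp
next
  case (insert i I)
  have "E (\<lambda>x. 1 *\<^sub>R (u x + r *\<^sub>R (\<Sum>i\<in>I. c i *\<^sub>R k i x)) + (r * c i) *\<^sub>R k i x) w
      = 1 * E (\<lambda>x. u x + r *\<^sub>R (\<Sum>i\<in>I. c i *\<^sub>R k i x)) w + (r * c i) * E (k i) w"
    using insert by (intro lin w linear_space_add_sum V u) auto
  then show ?case using insert by (simp add: algebra_simps)
qed

text \<open>
  This is why symplectic Runge-Kutta methods reproduce quadratic invariants and dissipation laws
  exactly.  Expanding \<open>E u1 u1\<close> gives a term linear in \<open>dt\<close>, namely \<open>2 dt \<Sum>\<^sub>i b\<^sub>i E(u0, k\<^sub>i)\<close>, and the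
  quadratic term \<open>dt\<^sup>2 \<Sum>\<^sub>i\<^sub>j b\<^sub>i b\<^sub>j E(k\<^sub>j, k\<^sub>i)\<close>.  Replacing \<open>u0\<close> by the stage \<open>U i\<close> in the former costs
  \<open>2 dt\<^sup>2 \<Sum>\<^sub>i\<^sub>j b\<^sub>i a\<^sub>i\<^sub>j E(k\<^sub>j, k\<^sub>i)\<close>, which by the symplectic condition and the symmetry of \<open>E\<close> is exactly
  the quadratic term.
\<close>

lemma symplectic_RK_quadratic_identity:
  fixes E :: "('x \<Rightarrow> 'a::real_vector) \<Rightarrow> ('x \<Rightarrow> 'a) \<Rightarrow> real"
  assumes V: "linear_space V"
    and lin: "\<And>u v w c d. \<lbrakk>u \<in> V; v \<in> V; w \<in> V\<rbrakk> \<Longrightarrow>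
      E (\<lambda>x. c *\<^sub>R u x + d *\<^sub>R v x) w = c * E u w + d * E v w"
    and sym: "\<And>u v. \<lbrakk>u \<in> V; v \<in> V\<rbrakk> \<Longrightarrow> E u v = E v u"
    and u0: "u0 \<in> V" and fin: "finite I" and k: "\<And>i. i \<in> I \<Longrightarrow> k i \<in> V"
    and symplectic: "\<And>i j. \<lbrakk>i \<in> I; j \<in> I\<rbrakk> \<Longrightarrow> b i * a i j + b j * a j i = b i * b j"
    and stage: "\<And>i. i \<in> I \<Longrightarrow> U i = (\<lambda>x. u0 x + dt *\<^sub>R (\<Sum>j\<in>I. a i j *\<^sub>R k j x))"
    and step: "u1 = (\<lambda>x. u0 x + dt *\<^sub>R (\<Sum>i\<in>I. b i *\<^sub>R k i x))"
  shows "E u1 u1 - E u0 u0 = 2 * dt * (\<Sum>i\<in>I. b i * E (U i) (k i))"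
proof -
  have u1: "u1 \<in> V" unfolding step by (rule linear_space_add_sum[OF V u0 fin k])
  have E1: "E u1 w = E u0 w + dt * (\<Sum>i\<in>I. b i * E (k i) w)" if "w \<in> V" for w
    unfolding step by (rule form_add_sum[OF V lin u0 that fin k])
  have EU: "E (U i) (k i) = E u0 (k i) + dt * (\<Sum>j\<in>I. a i j * E (k j) (k i))" if "i \<in> I" for i
    unfolding stage[OF that] by (rule form_add_sum[OF V lin u0 k[OF that] fin k])
  have "E u1 u1 = E u0 u1 + dt * (\<Sum>i\<in>I. b i * E u1 (k i))"
    using E1[OF u1] sym[OF u1 k] by simp
  also have "E u0 u1 = E u0 u0 + dt * (\<Sum>i\<in>I. b i * E u0 (k i))"
    using E1[OF u0] sym[OF u0 u1] sym[OF u0 k] by simp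
  also have "(\<Sum>i\<in>I. b i * E u1 (k i)) = (\<Sum>i\<in>I. b i * E u0 (k i))
      + dt * (\<Sum>i\<in>I. \<Sum>j\<in>I. b i * b j * E (k j) (k i))"
    using E1[OF k] by (simp add: algebra_simps sum.distrib sum_distrib_left)
  also have "(\<Sum>i\<in>I. \<Sum>j\<in>I. b i * b j * E (k j) (k i))
      = (\<Sum>i\<in>I. \<Sum>j\<in>I. b i * a i j * E (k j) (k i)) + (\<Sum>i\<in>I. \<Sum>j\<in>I. b j * a j i * E (k j) (k i))"
    by (simp add: symplectic[symmetric] distrib_right sum.distrib)
  also have "(\<Sum>i\<in>I. \<Sum>j\<in>I. b j * a j i * E (k j) (k i))
      = (\<Sum>i\<in>I. \<Sum>j\<in>I. b i * a i j * E (k j) (k i))"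
    by (subst sum.swap) (intro sum.cong refl, simp add: sym k)
  finally show ?thesis
    by (simp add: EU algebra_simps sum.distrib sum_distrib_left)
qed

section \<open>Integration by parts on the period cell\<close>

lemma has_derivative_vec_nth_frechet:
  fixes u :: "real^'d \<Rightarrow> 'b::euclidean_space^'m"
  assumes "u differentiable (at x)"
  shows "((\<lambda>y. u y $ i) has_derivative (\<lambda>h. frechet_derivative u (at x) h $ i)) (at x)"
  using assms by (intro bounded_linear.has_derivative[OF bounded_linear_vec_nth])
    (simp add: frechet_derivative_works)

lemma divergence_eq_frechet:
  fixes Q :: "real^'d \<Rightarrow> real^'d^'m"
  assumes "Q differentiable (at x)"
  shows "divergence Q x $ i = (\<Sum>k\<in>UNIV. frechet_derivative Q (at x) (axis k 1) $ i $ k)"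
proof -
  have "((\<lambda>y. Q y $ i $ k) has_derivative (\<lambda>h. frechet_derivative Q (at x) h $ i $ k)) (at x)" for k
    by (intro bounded_linear.has_derivative[OF bounded_linear_vec_nth]
        has_derivative_vec_nth_frechet assms)
  then have "frechet_derivative (\<lambda>y. Q y $ i $ k) (at x)
      = (\<lambda>h. frechet_derivative Q (at x) h $ i $ k)" for k
    by (rule frechet_derivative_at[symmetric])
  then show ?thesis
    by (simp add: divergence_def)
qed

text \<open>
  The left side is the divergence of the vector field \<open>Q\<^sup>T W\<close>; the right side expands it into
  partial derivatives of the scalar products \<open>Q\<^sub>i\<^sub>k W\<^sub>i\<close>.
\<close>

lemma divergence_pairing_eq:
  fixes Q :: "real^'d \<Rightarrow> real^'d^'m" and W :: "real^'d \<Rightarrow> real^'m"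
  assumes "Q differentiable (at x)"
  shows "Q x \<bullet> jacobian W (at x) + divergence Q x \<bullet> W x
    = (\<Sum>i\<in>UNIV. \<Sum>k\<in>UNIV. Q x $ i $ k * frechet_derivative W (at x) (axis k 1) $ i
        + frechet_derivative Q (at x) (axis k 1) $ i $ k * W x $ i)"
  by (simp add: inner_vec_def divergence_eq_frechet[OF assms] jacobian_def matrix_def
      sum.distrib sum_distrib_right)

text \<open>
  Integration by parts without boundary terms: every summand of the expanded divergence is a
  partial derivative of a periodic \<open>C\<^sup>1\<close> function, so it integrates to zero over a period cell.
\<close>

lemma periodic_divergence_pairing:
  fixes Q :: "real^'d \<Rightarrow> real^'d^'m" and W :: "real^'d \<Rightarrow> real^'m"
  assumes pos: "\<And>j. lo $ j < hi $ j"
    and Q: "C1_field Q" "box_periodic lo hi Q" and W: "C1_field W" "box_periodic lo hi W"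
  shows "has_bochner_integral (lebesgue_on (cbox lo hi))
    (\<lambda>x. Q x \<bullet> jacobian W (at x) + divergence Q x \<bullet> W x) 0"
proof -
  have dQ: "Q differentiable (at x)" and dW: "W differentiable (at x)" for x
    using Q W by (auto simp: C1_field_def)
  have cQ': "continuous_on UNIV (\<lambda>x. frechet_derivative Q (at x) v)"
    and cW': "continuous_on UNIV (\<lambda>x. frechet_derivative W (at x) v)" for v
    using Q W by (auto simp: C1_field_def)
  have cQ: "continuous_on UNIV Q" and cW: "continuous_on UNIV W"
    using dQ dW by (auto intro!: continuous_at_imp_continuous_on differentiable_imp_continuous_within)
  define d where "d i k x v = Q x $ i $ k * frechet_derivative W (at x) v $ i
        + frechet_derivative Q (at x) v $ i $ k * W x $ i" for i k x v
  have cont: "continuous_on UNIV (\<lambda>x. d i k x v)" for i k v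
    unfolding d_def by (intro continuous_intros cQ cW cQ' cW')
  have "has_bochner_integral (lebesgue_on (cbox lo hi)) (\<lambda>x. d i k x (axis k 1)) 0" for i k
  proof -
    have "((\<lambda>y. Q y $ i $ k * W y $ i) has_derivative d i k x) (at x)" for x
      unfolding d_def
      by (intro has_derivative_mult has_derivative_vec_nth_frechet dW
          bounded_linear.has_derivative[OF bounded_linear_vec_nth] dQ)
    then have 0: "integral (cbox lo hi) (\<lambda>x. d i k x (axis k 1)) = 0"
      using Q(2) W(2) cont pos
      by (intro integral_periodic_partial_derivative[where h = "\<lambda>y. Q y $ i $ k * W y $ i"])
        (auto simp: box_periodic_def)
    have int: "integrable (lebesgue_on (cbox lo hi)) (\<lambda>x. d i k x (axis k 1))"
      by (rule continuous_imp_integrable) (rule continuous_on_subset[OF cont], simp)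
    then show ?thesis
      using lebesgue_integral_eq_integral[OF int] 0 by (simp add: has_bochner_integral_iff)
  qed
  then have "has_bochner_integral (lebesgue_on (cbox lo hi))
      (\<lambda>x. \<Sum>i\<in>UNIV. \<Sum>k\<in>UNIV. d i k x (axis k 1)) (\<Sum>i\<in>(UNIV::'m set). \<Sum>k\<in>(UNIV::'d set). 0)"
    by (intro has_bochner_integral_sum)
  then show ?thesis
    by (simp add: divergence_pairing_eq[OF dQ] d_def)
qed

lemma jacobian_periodic:
  fixes u :: "real^'d \<Rightarrow> real^'m"
  assumes per: "box_periodic lo hi u" and diff: "\<And>x. u differentiable (at x)"
  shows "box_periodic lo hi (\<lambda>x. jacobian u (at x))"
  unfolding box_periodic_def
proof (intro allI)
  fix x :: "real^'d" and k
  define p where "p = (axis k (hi $ k - lo $ k) :: real^'d)"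
  have "((\<lambda>y. y + p) has_derivative (\<lambda>h. h)) (at x)"
    by (auto intro!: derivative_eq_intros)
  moreover have "(u has_derivative frechet_derivative u (at (x + p))) (at (x + p))"
    using diff[of "x + p"] unfolding frechet_derivative_works .
  ultimately have "((\<lambda>y. u (y + p)) has_derivative frechet_derivative u (at (x + p))) (at x)"
    by (rule has_derivative_compose)
  moreover have "(\<lambda>y. u (y + p)) = u"
    using per by (auto simp: box_periodic_def p_def)
  ultimately have "(u has_derivative frechet_derivative u (at (x + p))) (at x)"
    by simp
  then have "frechet_derivative u (at (x + p)) = frechet_derivative u (at x)"
    by (rule frechet_derivative_at)
  then show "jacobian u (at (x + axis k (hi $ k - lo $ k))) = jacobian u (at x)"
    by (simp add: jacobian_def p_def)
qed

section \<open>Adjointness and the sign of the quadratized mobility\<close>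

text \<open>
  A density that depends on \<open>\<Phi>\<close> only is paired with fields that may fail to be differentiable,
  whose Frechet derivatives are then arbitrary; this makes every term that contains one vanish.
\<close>

lemma dg_dGradPhi_zero:
  assumes "\<not> gradient_dependent g"
  shows "dg_dGradPhi g \<Phi> x = 0"
proof -
  have "\<exists>c. g (\<Phi> x) = (\<lambda>_. c)"
    using assms unfolding gradient_dependent_def by blast
  then obtain c where "g (\<Phi> x) = (\<lambda>_. c)" ..
  then show ?thesis
    by (simp add: dg_dGradPhi_def gradient_def)
qed

lemma divergence_zero: "divergence (\<lambda>y. 0) x = 0"
  by (simp add: divergence_def vec_eq_iff)

text \<open>
  The terms without derivatives in \<open>eq_A\<close> and \<open>eq_A_adj\<close> agree pointwise.  The integrands differ by a
  divergence, here called the defect, which integrates to zero by periodicity.  It is the defect as a whole and the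
  inner products as a whole that are integrable: the individual products, such as
  \<open>dg_dPhi g \<Phi> x \<bullet> W x\<close> times \<open>snd (v x)\<close>, need not be, so the integral is never split
  further.
\<close>

lemma eq_A_adjoint:
  fixes v :: "real^'d \<Rightarrow> (real^'m) \<times> real"
  assumes pos: "\<And>j. lo $ j < hi $ j"
    and \<Phi>: "box_periodic lo hi \<Phi>"
    and v: "v \<in> periodic_L2 lo hi" and Av: "eq_A g \<Phi> v \<in> periodic_L2 lo hi"
    and W: "W \<in> periodic_L2 lo hi" and AW: "eq_A_adj g \<Phi> W \<in> periodic_L2 lo hi"
    and C1: "gradient_dependent g \<Longrightarrow> (\<forall>x. \<Phi> differentiable (at x)) \<and>
        C1_field (\<lambda>x. snd (v x) *\<^sub>R dg_dGradPhi g \<Phi> x) \<and> C1_field W"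
  shows "L2_inner lo hi v (eq_A_adj g \<Phi> W) = L2_inner lo hi (eq_A g \<Phi> v) W"
proof -
  let ?M = "lebesgue_on (cbox lo hi)"
  define Q where "Q x = snd (v x) *\<^sub>R dg_dGradPhi g \<Phi> x" for x
  define defect where "defect x = Q x \<bullet> jacobian W (at x) + divergence Q x \<bullet> W x" for x
  have defect: "has_bochner_integral ?M defect 0"
  proof (cases "gradient_dependent g")
    case False
    then have "Q = (\<lambda>x. 0)" by (simp add: Q_def dg_dGradPhi_zero fun_eq_iff)
    then show ?thesis
      by (simp add: defect_def[abs_def] divergence_zero has_bochner_integral_zero)
  next
    case True
    then have "box_periodic lo hi (\<lambda>x. jacobian \<Phi> (at x))"
      using C1 \<Phi> by (intro jacobian_periodic) auto
    then have "box_periodic lo hi Q"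
      using \<Phi> v by (simp add: Q_def dg_dGradPhi_def box_periodic_def periodic_L2_def)
    then show ?thesis
      using C1[OF True] W pos unfolding defect_def
      by (intro periodic_divergence_pairing) (auto simp: Q_def[abs_def] periodic_L2_def)
  qed
  note sq = periodic_L2_sq_integrable
  have "v x \<bullet> eq_A_adj g \<Phi> W x = eq_A g \<Phi> v x \<bullet> W x + defect x" for x
    by (simp add: eq_A_def eq_A_adj_def defect_def Q_def[abs_def] inner_prod_def
        inner_add_left inner_diff_left distrib_left)
  \<comment> \<open>The divergence in \<open>eq_A\<close> enters with a minus sign, so it is added back by the defect.\<close>
  then have "L2_inner lo hi v (eq_A_adj g \<Phi> W)
      = integral\<^sup>L ?M (\<lambda>x. eq_A g \<Phi> v x \<bullet> W x + defect x)"
    by (simp add: L2_inner_eq_integral[OF sq[OF v] sq[OF AW]])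
  also have "\<dots> = integral\<^sup>L ?M (\<lambda>x. eq_A g \<Phi> v x \<bullet> W x)"
    using defect integrable_inner[OF sq[OF Av] sq[OF W]]
    by (simp add: has_bochner_integral_iff)
  finally show ?thesis
    by (simp add: L2_inner_eq_integral[OF sq[OF Av] sq[OF W]])
qed

text \<open>
  Since \<open>N = A\<^sup>* G A\<close>, moving \<open>A\<^sup>*\<close> to the other side turns the pairing into
  \<open>(Av, G(Av)) \<le> 0\<close>.
\<close>

lemma eq_N_negative_semidefinite:
  assumes pos: "\<And>j. lo $ j < hi $ j"
    and \<Psi>: "\<Psi> \<in> periodic_L2 lo hi"
    and v: "v \<in> eq_N_domain lo hi g G DG \<Psi>"
    and Nv: "eq_N g G \<Psi> v \<in> periodic_L2 lo hi"
    and G_op: "L2_operator lo hi (DG (fst \<circ> \<Psi>)) (G (fst \<circ> \<Psi>))"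
    and G_neg: "negative_semidefinite lo hi (DG (fst \<circ> \<Psi>)) (G (fst \<circ> \<Psi>))"
  shows "L2_inner lo hi v (eq_N g G \<Psi> v) \<le> 0"
proof -
  let ?\<Phi> = "fst \<circ> \<Psi>"
  have D: "eq_A g ?\<Phi> v \<in> DG ?\<Phi>" using v by (simp add: eq_N_domain_def)
  have "L2_inner lo hi v (eq_N g G \<Psi> v)
      = L2_inner lo hi (eq_A g ?\<Phi> v) (G ?\<Phi> (eq_A g ?\<Phi> v))"
    unfolding eq_N_def
  proof (rule eq_A_adjoint[OF pos])
    show "box_periodic lo hi ?\<Phi>" using \<Psi> by (simp add: periodic_L2_def box_periodic_def)
  qed (use v Nv D G_op in \<open>auto simp: eq_N_domain_def eq_N_def L2_operator_def\<close>)
  also have "\<dots> \<le> 0" using G_neg D by (simp add: negative_semidefinite_def)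
  finally show ?thesis .
qed

section \<open>The discrete energy law\<close>

theorem theorem3p4:
  fixes lo hi :: "real^'d"
    and A :: real
    and f :: "real^'m \<Rightarrow> real^'d^'m \<Rightarrow> real"
    and g :: "real^'m \<Rightarrow> real^'d^'m \<Rightarrow> real"
    and L :: "(real^'d \<Rightarrow> real^'m) \<Rightarrow> (real^'d \<Rightarrow> real^'m)"
    and DL :: "(real^'d \<Rightarrow> real^'m) set"
    and G :: "(real^'d \<Rightarrow> real^'m) \<Rightarrow> (real^'d \<Rightarrow> real^'m) \<Rightarrow> (real^'d \<Rightarrow> real^'m)"
    and DG :: "(real^'d \<Rightarrow> real^'m) \<Rightarrow> (real^'d \<Rightarrow> real^'m) set"
    and V :: "(real^'d \<Rightarrow> (real^'m) \<times> real) set"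
    and s :: nat
    and b :: "nat \<Rightarrow> real"
    and a :: "nat \<Rightarrow> nat \<Rightarrow> real"
    and dt :: real
    and \<Psi>0 \<Psi>1 :: "real^'d \<Rightarrow> (real^'m) \<times> real"
    and k \<Psi>s :: "nat \<Rightarrow> (real^'d \<Rightarrow> (real^'m) \<times> real)"
  assumes domain: "\<And>j. lo $ j < hi $ j"
    and f_bounded_below: "\<exists>c. \<forall>u p. c \<le> f u p"
    and A_large: "\<And>u p. 0 \<le> f u p + A / measure lebesgue (cbox lo hi)"
    and g_eq: "g = eq_g lo hi A f"
    and g_diff: "\<And>z. (\<lambda>(u, p). g u p) differentiable (at z)"
    and L_op: "L2_operator lo hi DL L"
    and L_self_adjoint: "self_adjoint lo hi DL L"
    and L_pos_def: "positive_definite lo hi DL L"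
    and G_op: "\<And>\<Phi>. L2_operator lo hi (DG \<Phi>) (G \<Phi>)"
    and G_neg: "\<And>\<Phi>. negative_semidefinite lo hi (DG \<Phi>) (G \<Phi>)"
    and V_space: "linear_space V"
    and V_L2: "V \<subseteq> periodic_L2 lo hi"
    and V_B: "\<And>\<Psi>. \<Psi> \<in> V \<Longrightarrow> fst \<circ> \<Psi> \<in> DL"
    and V_N: "\<And>\<Psi>. \<Psi> \<in> V \<Longrightarrow> eq_B L \<Psi> \<in> eq_N_domain lo hi g G DG \<Psi>"
    and s: "s \<ge> 1"
    and symplectic: "\<And>i j. i \<in> {1..s} \<Longrightarrow> j \<in> {1..s} \<Longrightarrow> b i * a i j + b j * a j i = b i * b j"
    and b_nonneg: "\<And>i. i \<in> {1..s} \<Longrightarrow> b i \<ge> 0"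
    and dt: "dt > 0"
    and \<Psi>0_V: "\<Psi>0 \<in> V"
    and k_V: "\<And>i. i \<in> {1..s} \<Longrightarrow> k i \<in> V"
    and stage: "\<And>i. i \<in> {1..s} \<Longrightarrow> \<Psi>s i = (\<lambda>x. \<Psi>0 x + dt *\<^sub>R (\<Sum>j=1..s. a i j *\<^sub>R k j x))"
    and k_eq: "\<And>i. i \<in> {1..s} \<Longrightarrow> k i = eq_N g G (\<Psi>s i) (eq_B L (\<Psi>s i))"
    and step: "\<Psi>1 = (\<lambda>x. \<Psi>0 x + dt *\<^sub>R (\<Sum>i=1..s. b i *\<^sub>R k i x))"
  shows "eq_energy lo hi L A \<Psi>1 - eq_energy lo hi L A \<Psi>0
           = dt * (\<Sum>i=1..s. b i * L2_inner lo hi (eq_B L (\<Psi>s i)) (eq_N g G (\<Psi>s i) (eq_B L (\<Psi>s i))))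
       \<and> dt * (\<Sum>i=1..s. b i * L2_inner lo hi (eq_B L (\<Psi>s i)) (eq_N g G (\<Psi>s i) (eq_B L (\<Psi>s i)))) \<le> 0"
proof -
  define E where "E u v = L2_inner lo hi u (eq_B L v)" for u v
  note sq = periodic_L2_sq_integrable
  have BV: "eq_B L u \<in> periodic_L2 lo hi" if "u \<in> V" for u
    using V_N[OF that] by (simp add: eq_N_domain_def)
  have lin: "E (\<lambda>x. c *\<^sub>R u x + d *\<^sub>R v x) w = c * E u w + d * E v w"
    if "u \<in> V" "v \<in> V" "w \<in> V" for u v w c d
    unfolding E_def
    using that V_L2 V_space BV
    by (intro L2_inner_linear_left sq) (auto simp: linear_space_def)
  have E_split: "E u v = L2_inner lo hi (fst \<circ> u) (L (fst \<circ> v))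
     + integral\<^sup>L (lebesgue_on (cbox lo hi)) (\<lambda>x. snd (u x) * snd (v x))"
    if "u \<in> V" "v \<in> V" for u v
    unfolding E_def using that V_L2 BV by (intro L2_inner_eq_B sq) auto
  have sym: "E u v = E v u" if "u \<in> V" "v \<in> V" for u v
  proof -
    have "L2_inner lo hi (fst \<circ> u) (L (fst \<circ> v)) = L2_inner lo hi (fst \<circ> v) (L (fst \<circ> u))"
      using L_self_adjoint V_B that by (metis self_adjoint_def L2_inner_commute)
    then show ?thesis using that by (simp add: E_split mult.commute)
  qed
  have energy: "eq_energy lo hi L A u = E u u / 2 - A" if "u \<in> V" for u
  proof -
    have "0 \<le> L2_inner lo hi (fst \<circ> u) (L (fst \<circ> u))"
      using V_B[OF that] L_op
      by (intro L2_inner_nonneg_of_positive_definite[OF L_pos_def]) (auto simp: L2_operator_def)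
    then have "0 \<le> E u u"
      using that by (simp add: E_split)
    then show ?thesis by (simp add: eq_energy_def B_norm_def E_def)
  qed
  have \<Psi>1_V: "\<Psi>1 \<in> V"
    unfolding step by (intro linear_space_add_sum V_space \<Psi>0_V k_V) auto
  have \<Psi>s_V: "\<Psi>s i \<in> V" if "i \<in> {1..s}" for i
    unfolding stage[OF that] by (intro linear_space_add_sum V_space \<Psi>0_V k_V) auto
  have "E \<Psi>1 \<Psi>1 - E \<Psi>0 \<Psi>0 = 2 * dt * (\<Sum>i=1..s. b i * E (\<Psi>s i) (k i))"
    by (rule symplectic_RK_quadratic_identity[OF V_space lin sym \<Psi>0_V _ k_V symplectic stage step])
      auto
  also have "(\<Sum>i=1..s. b i * E (\<Psi>s i) (k i))
      = (\<Sum>i=1..s. b i * L2_inner lo hi (eq_B L (\<Psi>s i)) (eq_N g G (\<Psi>s i) (eq_B L (\<Psi>s i))))"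
  proof (intro sum.cong refl)
    fix i assume i: "i \<in> {1..s}"
    have "E (\<Psi>s i) (k i) = L2_inner lo hi (eq_B L (\<Psi>s i)) (k i)"
      using sym[OF \<Psi>s_V[OF i] k_V[OF i]] by (simp add: E_def L2_inner_commute)
    then show "b i * E (\<Psi>s i) (k i)
        = b i * L2_inner lo hi (eq_B L (\<Psi>s i)) (eq_N g G (\<Psi>s i) (eq_B L (\<Psi>s i)))"
      using k_eq[OF i] by simp
  qed
  finally have law: "eq_energy lo hi L A \<Psi>1 - eq_energy lo hi L A \<Psi>0
      = dt * (\<Sum>i=1..s. b i * L2_inner lo hi (eq_B L (\<Psi>s i)) (eq_N g G (\<Psi>s i) (eq_B L (\<Psi>s i))))"
    by (simp add: energy \<Psi>0_V \<Psi>1_V field_simps)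
  have "L2_inner lo hi (eq_B L (\<Psi>s i)) (eq_N g G (\<Psi>s i) (eq_B L (\<Psi>s i))) \<le> 0"
    if i: "i \<in> {1..s}" for i
    using \<Psi>s_V[OF i] k_V[OF i] V_L2 k_eq[OF i]
    by (intro eq_N_negative_semidefinite[where DG = DG] domain V_N G_op G_neg) auto
  then have "dt * (\<Sum>i=1..s. b i * L2_inner lo hi (eq_B L (\<Psi>s i)) (eq_N g G (\<Psi>s i) (eq_B L (\<Psi>s i)))) \<le> 0"
    using b_nonneg dt by (intro mult_nonneg_nonpos sum_nonpos) auto
  with law show ?thesis by blast
qed

end
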